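(* Let $\alpha>0$, $m,k,n\in\mathbb{N}$, $\tau_i>0$, $\delta_i\in\mathbb{R}$ $(i=1,\dots,m)$, and consider the non-linear time-fractional PDE with several time delays $$\frac{\partial^\alpha u}{\partial t^\alpha}=\mathcal{F}[u,\bar u_i]\equiv\mathcal{N}[u]+\sum_{i=1}^{m}\delta_i\bar u_i,\qquad t>0,\tag{$*$}$$ with $u=u(x,t)$ prescribed for $t\in[-\tau^*,0]$, $\tau^*=\max\{\tau_1,\dots,\tau_m\}$, where $\bar u_i=u(x,t-\tau_i)$ and $\mathcal{N}[u]=N\left[x,u,\frac{\partial u}{\partial x},\dots,\frac{\partial^k u}{\partial x^k}\right]$ is a non-linear differential operator of order $k$. Let $\mathcal{W}_n=\mathrm{Span}\{\varphi_1(x),\dots,\varphi_n(x)\}$ be the $n$-dimensional solution space of a linear ODE $a_n z^{(n)}+a_{n-1}z^{(n-1)}+\dots+a_1z'+a_0z=0$ with real coefficients, with $\varphi_1,\dots,\varphi_n$ linearly independent. If $\mathcal{W}_n$ is invariant under $\mathcal{F}[u,\bar u_i]$, then $( * )$ possesses generalized separable solutions of the form $$u(x,t)=\sum_{j=1}^{n}A_j(t)\varphi_j(x),$$ where the coefficients $A_j(t)$ satisfy the system of fractional delay ODEs $$\frac{d^\alpha A_j(t)}{dt^\alpha}=\Theta_j(A_1(t),\dots,A_n(t))+\sum_{i=1}^{m}\delta_iA_j(t-\tau_i),\qquad j=1,\dots,n;$$ that is, if $A_1,\dots,A_n$ satisfy this system for $t>0$, then $u$ satisfies $( * )$.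
   Context: The derivative $\partial^\alpha/\partial t^\alpha$ (and $d^\alpha/dt^\alpha$) is the Caputo fractional derivative in $t$: for $p-1<\alpha<p$, $p\in\mathbb{N}$, $\frac{d^\alpha\varphi(t)}{dt^\alpha}=\frac{1}{\Gamma(p-\alpha)}\int_0^t\frac{\varphi^{(p)}(s)}{(t-s)^{\alpha-p+1}}\,ds$, and $\frac{d^\alpha\varphi}{dt^\alpha}=\varphi^{(p)}$ for $\alpha=p$. The space $\mathcal{W}_n$ is said to be invariant under $\mathcal{F}[u,\bar u_i]=\mathcal{N}[u]+\sum_i\delta_i\bar u_i$ if $\mathcal{N}[\mathcal{W}_n]\subseteq\mathcal{W}_n$, i.e. $\mathcal{N}[u]\in\mathcal{W}_n$ for all $u\in\mathcal{W}_n$. In that case $\Theta_1,\dots,\Theta_n$ denote the expansion coefficients of $\mathcal{N}$ in the basis $\varphi_1,\dots,\varphi_n$: $\mathcal{N}\left[\sum_{j=1}^nA_j\varphi_j(x)\right]=\sum_{j=1}^n\Theta_j(A_1,\dots,A_n)\varphi_j(x)$ for all real $A_1,\dots,A_n$. *)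

theory Defs
  imports "HOL-Analysis.Analysis"
begin

text \<open>
  The Caputo derivative of order \<open>\<alpha> > 0\<close> with base point 0. Here \<open>nat \<lceil>\<alpha>\<rceil>\<close> is the unique
  \<open>p \<ge> 1\<close> with \<open>p - 1 < \<alpha> \<le> p\<close>. Both \<^const>\<open>deriv\<close> and the Lebesgue integral are total, so
  the value is meaningful only under \<open>caputo_differentiable\<close>, which collects exactly what is needed
  for the formula to make sense at every \<open>t > 0\<close>. Differentiability at \<open>t = 0\<close> is
  not required: typical solutions behave like \<open>t powr \<alpha>\<close> there.
\<close>

definition caputo_deriv :: "real \<Rightarrow> (real \<Rightarrow> real) \<Rightarrow> real \<Rightarrow> real" where
  "caputo_deriv \<alpha> f t =
    (let p = nat \<lceil>\<alpha>\<rceil> in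
      if \<alpha> = real p then (deriv ^^ p) f t
      else 1 / Gamma (real p - \<alpha>) *
        (LINT s:{0<..<t}|lborel. (deriv ^^ p) f s / (t - s) powr (\<alpha> - real p + 1)))"

definition caputo_differentiable :: "real \<Rightarrow> (real \<Rightarrow> real) \<Rightarrow> bool" where
  "caputo_differentiable \<alpha> f \<longleftrightarrow>
    (let p = nat \<lceil>\<alpha>\<rceil> in
      (\<forall>i<p. (deriv ^^ i) f differentiable_on {0<..}) \<and>
      (\<alpha> \<noteq> real p \<longrightarrow>
        (\<forall>t>0. set_integrable lborel {0<..<t}
          (\<lambda>s. (deriv ^^ p) f s / (t - s) powr (\<alpha> - real p + 1)))))"

text \<open>
  \<open>N x [v x, v' x, \<dots>]\<close>, the list holding the derivatives of orders \<open>0, \<dots>, k\<close>.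
\<close>

definition diff_operator ::
  "nat \<Rightarrow> (real \<Rightarrow> real list \<Rightarrow> real) \<Rightarrow> (real \<Rightarrow> real) \<Rightarrow> real \<Rightarrow> real" where
  "diff_operator k N v x = N x (map (\<lambda>i. (deriv ^^ i) v x) [0..<Suc k])"

text \<open>
  Function spaces. The library has no vector space structure on \<^typ>\<open>real \<Rightarrow> real\<close>, so span and
  linear independence of a family indexed by \<open>{1..n}\<close> are written out.
\<close>

definition lin_comb :: "nat \<Rightarrow> (nat \<Rightarrow> real \<Rightarrow> real) \<Rightarrow> (nat \<Rightarrow> real) \<Rightarrow> real \<Rightarrow> real" where
  "lin_comb n \<phi> c = (\<lambda>x. \<Sum>j=1..n. c j * \<phi> j x)"

definition fun_span :: "nat \<Rightarrow> (nat \<Rightarrow> real \<Rightarrow> real) \<Rightarrow> (real \<Rightarrow> real) set" where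
  "fun_span n \<phi> = range (lin_comb n \<phi>)"

definition fun_independent :: "nat \<Rightarrow> (nat \<Rightarrow> real \<Rightarrow> real) \<Rightarrow> bool" where
  "fun_independent n \<phi> \<longleftrightarrow>
    (\<forall>c. (\<forall>x. lin_comb n \<phi> c x = 0) \<longrightarrow> (\<forall>j\<in>{1..n}. c j = 0))"

definition linear_ode_solutions :: "nat \<Rightarrow> (nat \<Rightarrow> real) \<Rightarrow> (real \<Rightarrow> real) set" where
  "linear_ode_solutions n a =
    {z. (\<forall>i<n. (deriv ^^ i) z differentiable_on UNIV) \<and>
        (\<forall>x. (\<Sum>i\<le>n. a i * (deriv ^^ i) z x) = 0)}"

text \<open>
  Invariance under the delay operator \<open>N[u] + (\<Sum>i. \<delta> i * u(x, t - \<tau> i))\<close> means, by definition,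
  that \<open>N\<close> maps the space into itself.
\<close>

definition invariant_space ::
  "(real \<Rightarrow> real) set \<Rightarrow> nat \<Rightarrow> (real \<Rightarrow> real list \<Rightarrow> real) \<Rightarrow> bool" where
  "invariant_space W k N \<longleftrightarrow> (\<forall>v\<in>W. diff_operator k N v \<in> W)"

text \<open>
  Coordinates with respect to \<open>\<phi> 1, \<dots>, \<phi> n\<close>; the entries outside \<open>{1..n}\<close> are set to 0 only to
  make the description unique. For an invariant space, \<open>expansion_coeff \<dots> j\<close> is \<open>\<Theta>\<^sub>j\<close>.
\<close>

definition fun_coords :: "nat \<Rightarrow> (nat \<Rightarrow> real \<Rightarrow> real) \<Rightarrow> (real \<Rightarrow> real) \<Rightarrow> nat \<Rightarrow> real" where
  "fun_coords n \<phi> v = (THE c. v = lin_comb n \<phi> c \<and> (\<forall>j. j \<notin> {1..n} \<longrightarrow> c j = 0))"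

definition expansion_coeff ::
  "nat \<Rightarrow> (nat \<Rightarrow> real \<Rightarrow> real) \<Rightarrow> nat \<Rightarrow> (real \<Rightarrow> real list \<Rightarrow> real) \<Rightarrow> nat \<Rightarrow> (nat \<Rightarrow> real) \<Rightarrow> real" where
  "expansion_coeff n \<phi> k N j A = fun_coords n \<phi> (diff_operator k N (lin_comb n \<phi> A)) j"

lemma lin_comb_fun_coords:
  assumes "fun_independent n \<phi>" and "v \<in> fun_span n \<phi>"
  shows "lin_comb n \<phi> (fun_coords n \<phi> v) = v"
proof -
  obtain c where c: "v = lin_comb n \<phi> c"
    using assms(2) by (auto simp: fun_span_def)
  let ?c = "\<lambda>j. if j \<in> {1..n} then c j else 0"
  let ?P = "\<lambda>c. v = lin_comb n \<phi> c \<and> (\<forall>j. j \<notin> {1..n} \<longrightarrow> c j = 0)"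
  have P: "?P ?c"
    by (simp add: c lin_comb_def)
  have "d = ?c" if d: "?P d" for d
  proof
    fix j
    have "lin_comb n \<phi> (\<lambda>j. d j - ?c j) x = lin_comb n \<phi> d x - lin_comb n \<phi> ?c x" for x
      unfolding lin_comb_def by (simp only: left_diff_distrib sum_subtractf)
    moreover have "lin_comb n \<phi> d = v" and "lin_comb n \<phi> ?c = v"
      by (rule conjunct1[OF d, symmetric], rule conjunct1[OF P, symmetric])
    ultimately have "\<forall>x. lin_comb n \<phi> (\<lambda>j. d j - ?c j) x = 0"
      by (simp only: diff_self simp_thms)
    then have "\<forall>j\<in>{1..n}. d j - ?c j = 0"
      using assms(1) unfolding fun_independent_def by blast
    then show "d j = ?c j"
      using d by (cases "j \<in> {1..n}") auto
  qed
  then have "?P (fun_coords n \<phi> v)"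
    unfolding fun_coords_def by (rule theI[of ?P, OF P])
  then show ?thesis by simp
qed

lemma expansion_coeff:
  assumes "fun_independent n \<phi>" and "invariant_space (fun_span n \<phi>) k N"
  shows "diff_operator k N (\<lambda>x. \<Sum>j=1..n. A j * \<phi> j x) x =
    (\<Sum>j=1..n. expansion_coeff n \<phi> k N j A * \<phi> j x)"
proof -
  have "diff_operator k N (lin_comb n \<phi> A) \<in> fun_span n \<phi>"
    using assms(2) by (auto simp: invariant_space_def fun_span_def)
  from fun_cong[OF lin_comb_fun_coords[OF assms(1) this], of x] show ?thesis
    unfolding expansion_coeff_def lin_comb_def by (rule sym)
qed

text \<open>
  Solutions for \<open>t > 0\<close> with history prescribed on \<open>[-\<tau>*, 0]\<close>, where \<open>\<tau>* = max {\<tau> 1, \<dots>, \<tau> m}\<close>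
  (\<open>\<psi>\<close> for the PDE, \<open>H\<close> for the system). Being a solution includes the existence of all the
  derivatives that occur in the equation.
\<close>

definition solves_delay_pde ::
  "real \<Rightarrow> nat \<Rightarrow> (real \<Rightarrow> real list \<Rightarrow> real) \<Rightarrow> nat \<Rightarrow> (nat \<Rightarrow> real) \<Rightarrow> (nat \<Rightarrow> real) \<Rightarrow>
    (real \<Rightarrow> real \<Rightarrow> real) \<Rightarrow> (real \<Rightarrow> real \<Rightarrow> real) \<Rightarrow> bool" where
  "solves_delay_pde \<alpha> k N m \<delta> \<tau> \<psi> u \<longleftrightarrow>
    (\<forall>x. \<forall>t\<in>{- Max (\<tau> ` {1..m})..0}. u x t = \<psi> x t) \<and>
    (\<forall>x. caputo_differentiable \<alpha> (\<lambda>t. u x t)) \<and>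
    (\<forall>t>0. \<forall>i<k. (deriv ^^ i) (\<lambda>x. u x t) differentiable_on UNIV) \<and>
    (\<forall>x. \<forall>t>0. caputo_deriv \<alpha> (\<lambda>s. u x s) t =
      diff_operator k N (\<lambda>y. u y t) x + (\<Sum>i=1..m. \<delta> i * u x (t - \<tau> i)))"

definition solves_delay_system ::
  "real \<Rightarrow> nat \<Rightarrow> (nat \<Rightarrow> (nat \<Rightarrow> real) \<Rightarrow> real) \<Rightarrow> nat \<Rightarrow> (nat \<Rightarrow> real) \<Rightarrow> (nat \<Rightarrow> real) \<Rightarrow>
    (nat \<Rightarrow> real \<Rightarrow> real) \<Rightarrow> (nat \<Rightarrow> real \<Rightarrow> real) \<Rightarrow> bool" where
  "solves_delay_system \<alpha> n \<Theta> m \<delta> \<tau> H A \<longleftrightarrow>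
    (\<forall>j\<in>{1..n}.
      (\<forall>t\<in>{- Max (\<tau> ` {1..m})..0}. A j t = H j t) \<and>
      caputo_differentiable \<alpha> (A j) \<and>
      (\<forall>t>0. caputo_deriv \<alpha> (A j) t =
        \<Theta> j (\<lambda>l. A l t) + (\<Sum>i=1..m. \<delta> i * A j (t - \<tau> i))))"

end

theory Submission
  imports Defs
begin

text \<open>
  On the half line \<open>{0<..}\<close> the Caputo derivative is linear, and the delay terms are linear too, so
  \<open>(d/dt)\<^sup>\<alpha> u\<close> is the combination of the \<open>\<phi> j\<close> whose coefficients are the right-hand sides of the
  system; by invariance the \<open>\<Theta>\<^sub>j\<close> part sums to \<open>N[u]\<close>. The spatial derivatives up to order \<open>k\<close> exist,
  even if \<open>k > n\<close>, because \<open>\<phi> j\<close> solves a linear ODE with constant coefficients: the solution space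
  is closed under differentiation.
\<close>

text \<open>Induction on \<open>i\<close>. The set \<open>S\<close> is \<open>{0<..}\<close> for the
  time variable, where the coefficients need be differentiable for positive times only, and
  \<open>UNIV\<close> for the space variable.\<close>

lemma higher_deriv_sum:
  fixes g :: "'i \<Rightarrow> real \<Rightarrow> real"
  assumes "open S" and "finite J"
    and diff: "\<And>j i. j \<in> J \<Longrightarrow> i < p \<Longrightarrow> (deriv ^^ i) (g j) differentiable_on S"
    and "i \<le> p" and "t \<in> S"
  shows "(deriv ^^ i) (\<lambda>t. \<Sum>j\<in>J. c j * g j t) t = (\<Sum>j\<in>J. c j * (deriv ^^ i) (g j) t)"
  using assms(4,5)
proof (induction i arbitrary: t)
  case 0
  then show ?case by simp
next
  case (Suc i)
  have "((deriv ^^ i) (g j) has_field_derivative deriv ((deriv ^^ i) (g j)) t) (at t)"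
    if "j \<in> J" for j
    using diff[OF that, of i] Suc.prems \<open>open S\<close>
    by (simp add: differentiable_on_eq_differentiable_at DERIV_deriv_iff_real_differentiable)
  then have "((\<lambda>t. \<Sum>j\<in>J. c j * (deriv ^^ i) (g j) t) has_field_derivative
      (\<Sum>j\<in>J. c j * deriv ((deriv ^^ i) (g j)) t)) (at t)"
    by (intro DERIV_sum DERIV_cmult)
  \<comment> \<open>The induction hypothesis identifies the two functions on \<open>S\<close> only;
    as \<open>S\<close> is an open neighbourhood of \<open>t\<close>, their derivatives at
    \<open>t\<close> agree as well.\<close>
  then have "((deriv ^^ i) (\<lambda>t. \<Sum>j\<in>J. c j * g j t) has_field_derivative
      (\<Sum>j\<in>J. c j * deriv ((deriv ^^ i) (g j)) t)) (at t)"
    by (rule has_field_derivative_transform_within_open[OF _ \<open>open S\<close> \<open>t \<in> S\<close>])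
      (use Suc in auto)
  then show ?case
    by (simp add: DERIV_imp_deriv)
qed

lemma higher_deriv_sum_differentiable_on:
  fixes g :: "'i \<Rightarrow> real \<Rightarrow> real"
  assumes "open S" and "finite J"
    and diff: "\<And>j i. j \<in> J \<Longrightarrow> i < p \<Longrightarrow> (deriv ^^ i) (g j) differentiable_on S"
    and "i < p"
  shows "(deriv ^^ i) (\<lambda>t. \<Sum>j\<in>J. c j * g j t) differentiable_on S"
proof -
  have "(\<lambda>t. \<Sum>j\<in>J. c j * (deriv ^^ i) (g j) t) differentiable_on S"
    unfolding differentiable_on_def
  proof
    fix t assume "t \<in> S"
    then show "(\<lambda>t. \<Sum>j\<in>J. c j * (deriv ^^ i) (g j) t) differentiable at t within S"
      using diff[OF _ \<open>i < p\<close>] \<open>finite J\<close>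
      by (intro differentiable_sum differentiable_mult differentiable_const ballI)
        (auto simp: differentiable_on_def)
  qed
  \<comment> \<open>The two functions agree on all of \<open>S\<close>, so any radius, here 1,
    serves for differentiability within \<open>S\<close>.\<close>
  then show ?thesis
    using higher_deriv_sum[OF assms(1-3), of i] \<open>i < p\<close>
    unfolding differentiable_on_def
    by (auto intro: differentiable_transform_within[OF _ zero_less_one])
qed

text \<open>Since \<open>a n \<noteq> 0\<close>, the equation expresses the \<open>n\<close>-th
  derivative through lower ones, which are differentiable. So \<open>z\<close> has one derivative
  more than membership demands, and differentiating the equation, whose coefficients are constant,
  gives the same equation for \<open>deriv z\<close>.\<close>

lemma deriv_linear_ode_solutions:
  assumes "n \<ge> 1" and "a n \<noteq> 0" and z: "z \<in> linear_ode_solutions n a"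
  shows "deriv z \<in> linear_ode_solutions n a"
proof -
  have low: "(deriv ^^ i) z differentiable_on UNIV" if "i < n" for i
    using z that by (simp add: linear_ode_solutions_def)
  have ode: "(\<Sum>i\<le>n. a i * (deriv ^^ i) z x) = 0" for x
    using z by (simp add: linear_ode_solutions_def)
  have top: "(deriv ^^ n) z = (\<lambda>x. \<Sum>i<n. (- a i / a n) * (deriv ^^ i) z x)"
  proof
    fix x
    have "a n * (deriv ^^ n) z x = - (\<Sum>i<n. a i * (deriv ^^ i) z x)"
      using ode[of x] by (simp add: lessThan_Suc_atMost[symmetric])
    then have "(deriv ^^ n) z x = - (\<Sum>i<n. a i * (deriv ^^ i) z x) / a n"
      using \<open>a n \<noteq> 0\<close> by (simp add: field_simps)
    then show "(deriv ^^ n) z x = (\<Sum>i<n. (- a i / a n) * (deriv ^^ i) z x)"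
      by (simp add: sum_negf sum_divide_distrib)
  qed
  have "(deriv ^^ n) z differentiable_on UNIV"
    unfolding top differentiable_on_def using low
    by (intro ballI differentiable_sum differentiable_mult differentiable_const)
      (auto simp: differentiable_on_def)
  then have diff: "(deriv ^^ i) z differentiable_on UNIV" if "i \<le> n" for i
    using low that by (cases "i = n") auto
  have "(\<Sum>i\<le>n. a i * (deriv ^^ Suc i) z x) = 0" for x
  proof -
    have "((deriv ^^ i) z has_field_derivative (deriv ^^ Suc i) z x) (at x)" if "i \<le> n" for i
      using diff[OF that]
      by (simp add: differentiable_on_def DERIV_deriv_iff_real_differentiable)
    then have "((\<lambda>x. \<Sum>i\<le>n. a i * (deriv ^^ i) z x) has_field_derivative
        (\<Sum>i\<le>n. a i * (deriv ^^ Suc i) z x)) (at x)"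
      by (intro DERIV_sum DERIV_cmult) auto
    \<comment> \<open>By \<open>ode\<close> the function differentiated here is constantly 0;
      uniqueness of the derivative gives the claim.\<close>
    then show ?thesis
      unfolding ode by (rule DERIV_unique[OF _ DERIV_const])
  qed
  moreover have "(deriv ^^ Suc i) z differentiable_on UNIV" if "i < n" for i
    using that by (intro diff) simp
  ultimately show ?thesis
    by (simp add: linear_ode_solutions_def funpow_Suc_right del: funpow.simps)
qed

text \<open>Every iterated derivative stays in the solution space, and since
  \<open>n \<ge> 1\<close>, membership includes differentiability of the function itself (index
  0).\<close>

lemma linear_ode_solutions_smooth:
  assumes "n \<ge> 1" and "a n \<noteq> 0" and "z \<in> linear_ode_solutions n a"
  shows "(deriv ^^ i) z differentiable_on UNIV"
proof -
  have "(deriv ^^ i) z \<in> linear_ode_solutions n a"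
    by (induction i) (use assms deriv_linear_ode_solutions in auto)
  then show ?thesis
    using \<open>n \<ge> 1\<close> by (auto simp: linear_ode_solutions_def dest: spec[of _ 0])
qed

text \<open>The coefficients are the Kronecker delta at \<open>j\<close>. When the span is the
  solution space, each \<open>\<phi> j\<close> thus solves the ODE.\<close>

lemma basis_in_fun_span:
  assumes "j \<in> {1..n}"
  shows "\<phi> j \<in> fun_span n \<phi>"
proof -
  have "(if l = j then 1 else 0) * \<phi> l x = (if l = j then \<phi> l x else 0)" for l x
    by simp
  then have "lin_comb n \<phi> (\<lambda>l. if l = j then 1 else 0) = \<phi> j"
    using assms by (simp add: lin_comb_def)
  then show ?thesis
    unfolding fun_span_def by (metis rangeI)
qed

lemma set_integrable_sum:
  fixes f :: "'i \<Rightarrow> 'a \<Rightarrow> real"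
  assumes "\<And>j. j \<in> J \<Longrightarrow> set_integrable M S (f j)"
  shows "set_integrable M S (\<lambda>s. \<Sum>j\<in>J. f j s)"
  using Bochner_Integration.integrable_sum[of J M "\<lambda>j s. indicator S s *\<^sub>R f j s"] assms
  by (simp add: set_integrable_def sum_distrib_left)

lemma set_integral_sum:
  fixes f :: "'i \<Rightarrow> 'a \<Rightarrow> real"
  assumes "\<And>j. j \<in> J \<Longrightarrow> set_integrable M S (f j)"
  shows "(LINT s:S|M. \<Sum>j\<in>J. f j s) = (\<Sum>j\<in>J. LINT s:S|M. f j s)"
  using Bochner_Integration.integral_sum[of J M "\<lambda>j s. indicator S s *\<^sub>R f j s"] assms
  by (simp add: set_integrable_def set_lebesgue_integral_def sum_distrib_left)

text \<open>In the application \<open>x\<close> is fixed, \<open>c j\<close> is the number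
  \<open>\<phi> j x\<close> and \<open>g j\<close> is the time coefficient
  \<open>A j\<close>.\<close>

context
  fixes \<alpha> :: real and J :: "'i set" and c :: "'i \<Rightarrow> real" and g :: "'i \<Rightarrow> real \<Rightarrow> real"
  assumes fin: "finite J"
    and caputo: "\<And>j. j \<in> J \<Longrightarrow> caputo_differentiable \<alpha> (g j)"
begin

private abbreviation "p \<equiv> nat \<lceil>\<alpha>\<rceil>"

private abbreviation "K h t s \<equiv> (deriv ^^ p) h s / (t - s) powr (\<alpha> - real p + 1)"

private lemma diff: "j \<in> J \<Longrightarrow> i < p \<Longrightarrow> (deriv ^^ i) (g j) differentiable_on {0<..}"
  using caputo by (auto simp: caputo_differentiable_def Let_def)

private lemma top_deriv:
  "s > 0 \<Longrightarrow> (deriv ^^ p) (\<lambda>t. \<Sum>j\<in>J. c j * g j t) s = (\<Sum>j\<in>J. c j * (deriv ^^ p) (g j) s)"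
  by (rule higher_deriv_sum[OF open_greaterThan fin diff order_refl]) auto

private lemma kernel_sum:
  "s > 0 \<Longrightarrow> K (\<lambda>t. \<Sum>j\<in>J. c j * g j t) t s = (\<Sum>j\<in>J. c j * K (g j) t s)"
  by (simp add: top_deriv sum_divide_distrib)

text \<open>Only a non-integer order involves an integral, and only then does
  \<open>caputo_differentiable\<close> provide integrability.\<close>

private lemma kernel_integrable:
  "j \<in> J \<Longrightarrow> \<alpha> \<noteq> real p \<Longrightarrow> t > 0 \<Longrightarrow> set_integrable lborel {0<..<t} (\<lambda>s. c j * K (g j) t s)"
  using caputo[of j] unfolding caputo_differentiable_def Let_def
  by (intro set_integrable_mult_right) auto

lemma caputo_differentiable_sum: "caputo_differentiable \<alpha> (\<lambda>t. \<Sum>j\<in>J. c j * g j t)"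
proof -
  have "set_integrable lborel {0<..<t} (K (\<lambda>t. \<Sum>j\<in>J. c j * g j t) t)"
    if "\<alpha> \<noteq> real p" "t > 0" for t
  proof -
    have "set_integrable lborel {0<..<t} (\<lambda>s. \<Sum>j\<in>J. c j * K (g j) t s)"
      using kernel_integrable that by (intro set_integrable_sum)
    \<comment> \<open>The integrands are known to agree for \<open>s > 0\<close> only, which covers
      the domain of integration.\<close>
    then show ?thesis
      by (subst set_integrable_cong[OF refl refl kernel_sum]) auto
  qed
  moreover have "(deriv ^^ i) (\<lambda>t. \<Sum>j\<in>J. c j * g j t) differentiable_on {0<..}" if "i < p" for i
    by (rule higher_deriv_sum_differentiable_on[OF open_greaterThan fin diff that])
  ultimately show ?thesis
    by (auto simp: caputo_differentiable_def Let_def)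
qed

text \<open>For integer order this is \<open>top_deriv\<close>. Otherwise the integral is additive
  because every summand is integrable; the default value 0 of a non-integrable integral could break
  additivity.\<close>

lemma caputo_deriv_sum:
  assumes "t > 0"
  shows "caputo_deriv \<alpha> (\<lambda>t. \<Sum>j\<in>J. c j * g j t) t = (\<Sum>j\<in>J. c j * caputo_deriv \<alpha> (g j) t)"
proof (cases "\<alpha> = real p")
  case True
  then show ?thesis
    using top_deriv[OF assms] by (simp add: caputo_deriv_def Let_def)
next
  case False
  have "(LINT s:{0<..<t}|lborel. K (\<lambda>t. \<Sum>j\<in>J. c j * g j t) t s) =
      (LINT s:{0<..<t}|lborel. \<Sum>j\<in>J. c j * K (g j) t s)"
    using kernel_sum by (intro set_lebesgue_integral_cong) auto
  also have "\<dots> = (\<Sum>j\<in>J. LINT s:{0<..<t}|lborel. c j * K (g j) t s)"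
    using kernel_integrable False assms by (intro set_integral_sum)
  also have "\<dots> = (\<Sum>j\<in>J. c j * (LINT s:{0<..<t}|lborel. K (g j) t s))"
    by (simp only: set_integral_mult_right)
  finally show ?thesis
    using False by (simp add: caputo_deriv_def Let_def sum_distrib_left mult.left_commute)
qed

end

theorem theorem5p1:
  fixes \<alpha> :: real and m k n :: nat
    and \<tau> \<delta> :: "nat \<Rightarrow> real"
    and N :: "real \<Rightarrow> real list \<Rightarrow> real"
    and a :: "nat \<Rightarrow> real"
    and \<phi> :: "nat \<Rightarrow> real \<Rightarrow> real"
  assumes "\<alpha> > 0" and "m \<ge> 1" and "k \<ge> 1" and "n \<ge> 1"
    and "\<And>i. i \<in> {1..m} \<Longrightarrow> \<tau> i > 0"
    and "a n \<noteq> 0"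
    and "fun_independent n \<phi>"
    and "fun_span n \<phi> = linear_ode_solutions n a"
    and "invariant_space (fun_span n \<phi>) k N"
  shows "\<forall>A H. solves_delay_system \<alpha> n (expansion_coeff n \<phi> k N) m \<delta> \<tau> H A \<longrightarrow>
    solves_delay_pde \<alpha> k N m \<delta> \<tau>
      (\<lambda>x t. \<Sum>j=1..n. H j t * \<phi> j x)
      (\<lambda>x t. \<Sum>j=1..n. A j t * \<phi> j x)"
proof (intro allI impI)
  fix A H
  assume "solves_delay_system \<alpha> n (expansion_coeff n \<phi> k N) m \<delta> \<tau> H A"
  then have hist: "\<And>j t. j \<in> {1..n} \<Longrightarrow> t \<in> {- Max (\<tau> ` {1..m})..0} \<Longrightarrow> A j t = H j t"
    and cd: "\<And>j. j \<in> {1..n} \<Longrightarrow> caputo_differentiable \<alpha> (A j)"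
    and eq: "\<And>j t. j \<in> {1..n} \<Longrightarrow> t > 0 \<Longrightarrow> caputo_deriv \<alpha> (A j) t =
      expansion_coeff n \<phi> k N j (\<lambda>l. A l t) + (\<Sum>i=1..m. \<delta> i * A j (t - \<tau> i))"
    unfolding solves_delay_system_def by blast+
  have smooth: "(deriv ^^ i) (\<phi> j) differentiable_on UNIV" if "j \<in> {1..n}" for i j
    using linear_ode_solutions_smooth[of n a "\<phi> j" i] basis_in_fun_span[OF that, of \<phi>] assms
    by simp
  have time: "(\<lambda>t. \<Sum>j=1..n. A j t * \<phi> j x) = (\<lambda>t. \<Sum>j=1..n. \<phi> j x * A j t)" for x
    by (simp add: mult.commute)
  have "caputo_differentiable \<alpha> (\<lambda>t. \<Sum>j=1..n. A j t * \<phi> j x)" for x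
    unfolding time by (rule caputo_differentiable_sum[OF finite_atLeastAtMost cd])
  \<comment> \<open>Now the numbers \<open>A j t\<close> are the constants and the
    \<open>\<phi> j\<close> the functions. The order \<open>i\<close> is arbitrary, so every
    \<open>k\<close> is covered.\<close>
  moreover have "(deriv ^^ i) (\<lambda>x. \<Sum>j=1..n. A j t * \<phi> j x) differentiable_on UNIV" for i t
    by (rule higher_deriv_sum_differentiable_on[OF open_UNIV finite_atLeastAtMost smooth lessI])
  moreover have "caputo_deriv \<alpha> (\<lambda>s. \<Sum>j=1..n. A j s * \<phi> j x) t =
      diff_operator k N (\<lambda>y. \<Sum>j=1..n. A j t * \<phi> j y) x +
      (\<Sum>i=1..m. \<delta> i * (\<Sum>j=1..n. A j (t - \<tau> i) * \<phi> j x))" if "t > 0" for x t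
  proof -
    have "caputo_deriv \<alpha> (\<lambda>s. \<Sum>j=1..n. A j s * \<phi> j x) t =
        (\<Sum>j=1..n. \<phi> j x * caputo_deriv \<alpha> (A j) t)"
      unfolding time by (rule caputo_deriv_sum[OF finite_atLeastAtMost cd that])
    \<comment> \<open>The system is inserted for each \<open>A j\<close> and its right-hand side
      split into the \<open>expansion_coeff\<close> part and the delay part.\<close>
    also have "\<dots> = (\<Sum>j=1..n. expansion_coeff n \<phi> k N j (\<lambda>l. A l t) * \<phi> j x) +
        (\<Sum>j=1..n. \<Sum>i=1..m. \<delta> i * (A j (t - \<tau> i) * \<phi> j x))"
      using that by (simp add: eq algebra_simps sum.distrib sum_distrib_left)
    also have "(\<Sum>j=1..n. \<Sum>i=1..m. \<delta> i * (A j (t - \<tau> i) * \<phi> j x)) =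
        (\<Sum>i=1..m. \<delta> i * (\<Sum>j=1..n. A j (t - \<tau> i) * \<phi> j x))"
      unfolding sum_distrib_left by (rule sum.swap)
    \<comment> \<open>Independence and invariance turn the sum of the \<open>expansion_coeff\<close>
      terms into the operator applied to \<open>u\<close> at time \<open>t\<close>.\<close>
    finally show ?thesis
      by (simp only: expansion_coeff[OF assms(7,9)])
  qed
  ultimately show "solves_delay_pde \<alpha> k N m \<delta> \<tau>
      (\<lambda>x t. \<Sum>j=1..n. H j t * \<phi> j x) (\<lambda>x t. \<Sum>j=1..n. A j t * \<phi> j x)"
    unfolding solves_delay_pde_def using hist by simp
qed

end
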